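(* Let $d\ge 1$ be an integer. There is a constant $C_d>0$, depending only on $d$, such that the following holds for every positive integer $t$: if $\gamma:[0,1]\to\mathbb{S}^d$ is a piecewise smooth, closed curve satisfying $$\frac{1}{\ell(\gamma)}\int_\gamma f=\int_{\mathbb{S}^d} f\qquad\text{for all } f\in\Pi_t,$$ then $$\ell(\gamma)\ \ge\ C_d\, t^{d-1}.$$
   Context: $\mathbb{S}^d=\{x\in\mathbb{R}^{d+1}:\|x\|=1\}$, and $\int_{\mathbb{S}^d}$ denotes integration with respect to the rotation-invariant surface measure normalized so that $\int_{\mathbb{S}^d}1=1$. $\Pi_t$ is the space of algebraic polynomials in $d+1$ real variables of total degree at most $t$. A curve is a continuous, piecewise (continuously) differentiable map $\gamma:[0,1]\to\mathbb{S}^d$ with at most finitely many self-intersections (all but finitely many points of $\gamma([0,1))$ are attained exactly once on $[0,1)$); it is closed if $\gamma(0)=\gamma(1)$. Its length is $\ell(\gamma)=\int_0^1\|\dot\gamma(s)\|\,ds$, assumed positive, and $\int_\gamma f=\int_0^1 f(\gamma(s))\|\dot\gamma(s)\|\,ds$. *)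

theory Defs
  imports "HOL-Probability.Probability"
begin

text \<open>
  The normalized surface measure on the unit sphere, as the cone measure: the push-forward of
  the uniform distribution on the unit ball under radial projection. It is a measure on the
  ambient space that is carried by the sphere. The origin, which is not projected to the sphere, is a null set.
\<close>
definition sphere_measure :: "'a::euclidean_space measure" where
  "sphere_measure = distr (uniform_measure lborel (ball 0 1)) borel (\<lambda>x. x /\<^sub>R norm x)"

text \<open>
  Polynomial functions of total degree at most \<open>t\<close>; the multi-index \<open>\<alpha>\<close> gives the exponent of
  each variable.
\<close>
definition poly_space :: "nat \<Rightarrow> (real ^ 'n \<Rightarrow> real) set" where
  "poly_space t =
     {\<lambda>x. \<Sum>\<alpha> | (\<Sum>i\<in>UNIV. \<alpha> i) \<le> t. c \<alpha> * (\<Prod>i\<in>UNIV. (x $ i) ^ \<alpha> i) | c :: ('n \<Rightarrow> nat) \<Rightarrow> real. True}"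

definition curve_length :: "(real \<Rightarrow> 'a::real_normed_vector) \<Rightarrow> real" where
  "curve_length \<gamma> = integral {0..1} (\<lambda>s. norm (vector_derivative \<gamma> (at s)))"

definition curve_integral :: "(real \<Rightarrow> 'a::real_normed_vector) \<Rightarrow> ('a \<Rightarrow> real) \<Rightarrow> real" where
  "curve_integral \<gamma> f = integral {0..1} (\<lambda>s. f (\<gamma> s) * norm (vector_derivative \<gamma> (at s)))"

text \<open>
  The predicate \<open>valid_path\<close> does not force the speed to be integrable near the finitely many
  exceptional parameters. A curve of infinite length has \<open>curve_length \<gamma> = 0\<close>, so
  the positivity condition excludes it.
\<close>
definition sphere_curve :: "(real \<Rightarrow> 'a::real_normed_vector) \<Rightarrow> bool" where
  "sphere_curve \<gamma> \<longleftrightarrow>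
     valid_path \<gamma> \<and> path_image \<gamma> \<subseteq> sphere 0 1 \<and>
     finite {p \<in> \<gamma> ` {0..<1}. \<not> (\<exists>!s. s \<in> {0..<1} \<and> \<gamma> s = p)} \<and>
     0 < curve_length \<gamma>"

text \<open>The index set of the sum in \<open>poly_space\<close> is finite, so that sum is a genuine one.\<close>

lemma finite_multi_indices: "finite {\<alpha> :: 'n::finite \<Rightarrow> nat. (\<Sum>i\<in>UNIV. \<alpha> i) \<le> t}"
proof (rule finite_subset)
  have "\<alpha> i \<le> t" if "(\<Sum>i\<in>UNIV. \<alpha> i) \<le> t" for \<alpha> :: "'n \<Rightarrow> nat" and i
    using member_le_sum[of i UNIV \<alpha>] that by simp
  then show "{\<alpha> :: 'n \<Rightarrow> nat. (\<Sum>i\<in>UNIV. \<alpha> i) \<le> t} \<subseteq> (\<Pi>\<^sub>E i\<in>UNIV. {..t})"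
    by (simp add: PiE_UNIV_domain subset_eq Pi_iff)
  show "finite (\<Pi>\<^sub>E i\<in>(UNIV :: 'n set). {..t})"
    by (intro finite_PiE) auto
qed

lemma measurable_radial [measurable]:
  "(\<lambda>x::'a::euclidean_space. x /\<^sub>R norm x) \<in> borel_measurable borel"
  by measurable

lemma emeasure_lborel_unit_ball:
  "emeasure lborel (ball (0::'a::euclidean_space) 1) \<noteq> 0"
  "emeasure lborel (ball (0::'a::euclidean_space) 1) \<noteq> \<infinity>"
proof -
  show "emeasure lborel (ball (0::'a) 1) \<noteq> 0"
    using open_not_negligible[of "ball (0::'a) 1"]
    by (auto simp: negligible_iff_null_sets null_sets_completionI null_sets_def)
  show "emeasure lborel (ball (0::'a) 1) \<noteq> \<infinity>"
    using emeasure_lborel_ball_finite[of "0::'a" 1] by auto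
qed

lemma prob_space_uniform_ball:
  "prob_space (uniform_measure lborel (ball (0::'a::euclidean_space) 1))"
  by (intro prob_space_uniform_measure emeasure_lborel_unit_ball)

text \<open>
  This justifies the definition of \<open>sphere_measure\<close>: it is a Borel probability measure, it is
  carried by the unit sphere, and it is invariant under all orthogonal transformations.
\<close>

lemma prob_space_sphere_measure: "prob_space (sphere_measure :: 'a::euclidean_space measure)"
  unfolding sphere_measure_def
  by (intro prob_space.prob_space_distr prob_space_uniform_ball) simp

lemma sets_sphere_measure [simp]: "sets sphere_measure = sets borel"
  by (simp add: sphere_measure_def)

lemma AE_sphere_measure: "AE x in (sphere_measure :: 'a::euclidean_space measure). x \<in> sphere 0 1"
proof -
  have "AE x in lborel. x \<noteq> (0::'a)"
    by (rule AE_lborel_singleton)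
  then have "AE x in uniform_measure lborel (ball (0::'a) 1). x \<noteq> 0"
    by (auto intro!: AE_uniform_measureI)
  then show ?thesis
    unfolding sphere_measure_def by (subst AE_distr_iff) (auto elim!: eventually_mono)
qed

lemma nn_integral_lborel_shift:
  fixes g :: "'a::euclidean_space \<Rightarrow> ennreal"
  assumes [measurable]: "g \<in> borel_measurable borel"
  shows "(\<integral>\<^sup>+x. g (c + x) \<partial>lborel) = (\<integral>\<^sup>+x. g x \<partial>lborel)"
proof -
  have "(\<integral>\<^sup>+x. g x \<partial>lborel) = (\<integral>\<^sup>+x. g x \<partial>distr lborel borel ((+) c))"
    by (simp only: lborel_distr_plus)
  also have "\<dots> = (\<integral>\<^sup>+x. g (c + x) \<partial>lborel)"
    by (subst nn_integral_distr) auto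
  finally show ?thesis ..
qed

lemma measurable_orthogonal_transformation:
  fixes f :: "'a::euclidean_space \<Rightarrow> 'a"
  assumes "orthogonal_transformation f"
  shows "f \<in> borel_measurable borel"
  using assms
  by (intro borel_measurable_continuous_onI linear_continuous_on linear_conv_bounded_linear[THEN iffD1]
      orthogonal_transformation_linear)

lemma distr_lborel_orthogonal_transformation:
  fixes f :: "'a::euclidean_space \<Rightarrow> 'a"
  assumes f: "orthogonal_transformation f"
  shows "distr lborel borel f = lborel"
proof (rule measure_eqI)
  fix A :: "'a set" assume "A \<in> sets (distr lborel borel f)"
  then have A [measurable]: "A \<in> sets borel" by simp
  note [measurable] = measurable_orthogonal_transformation[OF f]
  define B where "B = ball (0::'a) 1"
  have B [measurable]: "B \<in> sets borel" by (simp add: B_def)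
  obtain g where g: "\<And>x. f (g x) = x"
    using orthogonal_transformation_surj[OF f] by (metis surj_f_inv_f)
  have add: "f (x + y) = f x + f y" for x y
    using orthogonal_transformation_linear[OF f] by (rule linear_add)
  have norm: "norm (f x) = norm x" for x
    using orthogonal_transformation_norm[OF f] .
  have neg: "indicator B (x - f y) = (indicator B (- g x + y) :: ennreal)" for x y
  proof -
    have "norm (x - f y) = norm (f (g x - y))"
      using orthogonal_transformation_linear[OF f] by (simp add: linear_diff g)
    also have "\<dots> = norm (- g x + y)"
      by (simp add: norm norm_minus_commute)
    finally show ?thesis by (simp add: B_def indicator_def)
  qed
  have "emeasure lborel B * emeasure (distr lborel borel f) A
      = (\<integral>\<^sup>+x. indicator B x * (\<integral>\<^sup>+y. indicator A (f y) \<partial>lborel) \<partial>lborel)"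
    by (simp add: nn_integral_multc nn_integral_distr flip: nn_integral_indicator)
  also have "\<dots> = (\<integral>\<^sup>+x. indicator B x * (\<integral>\<^sup>+y. indicator A (x + f y) \<partial>lborel) \<partial>lborel)"
  proof (rule nn_integral_cong, rule arg_cong2[where f = "(*)"], rule refl)
    fix x
    show "(\<integral>\<^sup>+y. indicator A (f y) \<partial>lborel) = (\<integral>\<^sup>+y. (indicator A (x + f y) :: ennreal) \<partial>lborel)"
      using nn_integral_lborel_shift[of "\<lambda>y. indicator A (f y)" "g x"] by (simp add: add g)
  qed
  also have "\<dots> = (\<integral>\<^sup>+x. (\<integral>\<^sup>+y. indicator B x * indicator A (x + f y) \<partial>lborel) \<partial>lborel)"
    by (simp add: nn_integral_cmult)
  also have "\<dots> = (\<integral>\<^sup>+y. (\<integral>\<^sup>+x. indicator B x * indicator A (x + f y) \<partial>lborel) \<partial>lborel)"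
    by (rule lborel_pair.Fubini'[symmetric]) measurable
  also have "\<dots> = (\<integral>\<^sup>+y. (\<integral>\<^sup>+x. indicator A x * indicator B (x - f y) \<partial>lborel) \<partial>lborel)"
  proof (rule nn_integral_cong)
    fix y
    show "(\<integral>\<^sup>+x. indicator B x * indicator A (x + f y) \<partial>lborel)
        = (\<integral>\<^sup>+x. indicator A x * (indicator B (x - f y) :: ennreal) \<partial>lborel)"
      using nn_integral_lborel_shift[of "\<lambda>x. indicator A x * indicator B (x - f y)" "f y"]
      by (simp add: ac_simps)
  qed
  also have "\<dots> = (\<integral>\<^sup>+x. (\<integral>\<^sup>+y. indicator A x * indicator B (x - f y) \<partial>lborel) \<partial>lborel)"
    by (rule lborel_pair.Fubini') measurable
  also have "\<dots> = (\<integral>\<^sup>+x. indicator A x * (\<integral>\<^sup>+y. indicator B y \<partial>lborel) \<partial>lborel)"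
  proof (rule nn_integral_cong)
    fix x
    have "(\<integral>\<^sup>+y. indicator A x * indicator B (x - f y) \<partial>lborel)
        = indicator A x * (\<integral>\<^sup>+y. (indicator B (- g x + y) :: ennreal) \<partial>lborel)"
      by (simp add: neg nn_integral_cmult)
    also have "\<dots> = indicator A x * (\<integral>\<^sup>+y. indicator B y \<partial>lborel)"
      by (subst nn_integral_lborel_shift) auto
    finally show "(\<integral>\<^sup>+y. indicator A x * indicator B (x - f y) \<partial>lborel)
        = indicator A x * (\<integral>\<^sup>+y. (indicator B y :: ennreal) \<partial>lborel)" .
  qed
  also have "\<dots> = emeasure lborel B * emeasure lborel A"
    by (simp add: nn_integral_multc mult.commute)
  finally show "emeasure (distr lborel borel f) A = emeasure lborel A"
    using emeasure_lborel_unit_ball[where 'a = 'a]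
    by (simp add: ennreal_mult_cancel_left B_def)
qed simp

lemma distr_sphere_measure_orthogonal_transformation:
  fixes f :: "'a::euclidean_space \<Rightarrow> 'a"
  assumes f: "orthogonal_transformation f"
  shows "distr sphere_measure borel f = sphere_measure"
proof -
  note [measurable] = measurable_orthogonal_transformation[OF f]
  let ?U = "uniform_measure lborel (ball (0::'a) 1)"
  have norm: "norm (f x) = norm x" for x
    using orthogonal_transformation_norm[OF f] .
  have radial: "f (x /\<^sub>R norm x) = f x /\<^sub>R norm (f x)" for x
    using orthogonal_transformation_linear[OF f] by (simp add: linear_scale norm)
  have U: "distr ?U borel f = ?U"
  proof (rule measure_eqI)
    fix A :: "'a set" assume "A \<in> sets (distr ?U borel f)"
    then have A [measurable]: "A \<in> sets borel" by simp
    have "emeasure lborel (ball 0 1 \<inter> f -` A) = emeasure (distr lborel borel f) (ball 0 1 \<inter> A)"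
      by (subst emeasure_distr) (auto simp: norm intro!: arg_cong[where f = "emeasure lborel"])
    moreover have "f -` A \<in> sets borel"
      using measurable_sets_borel[OF measurable_orthogonal_transformation[OF f] A] .
    ultimately show "emeasure (distr ?U borel f) A = emeasure ?U A"
      by (simp add: emeasure_distr distr_lborel_orthogonal_transformation[OF f])
  qed simp
  have "distr sphere_measure borel f = distr ?U borel (\<lambda>x. f (x /\<^sub>R norm x))"
    unfolding sphere_measure_def by (subst distr_distr) (auto simp: o_def)
  also have "\<dots> = distr (distr ?U borel f) borel (\<lambda>x. x /\<^sub>R norm x)"
    by (subst distr_distr) (auto simp: o_def radial)
  also have "\<dots> = sphere_measure"
    by (simp add: U sphere_measure_def)
  finally show ?thesis .
qed

end

theory Submission
  imports Defs
begin

text \<open>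
  Let \<open>\<gamma>\<close> integrate \<open>\<Pi>\<^sub>t\<close> exactly and put \<open>x = \<gamma>(0)\<close>. The idea is to compare two estimates for the
  share of the curve that lies close to \<open>x\<close>. For some \<open>N\<close> comparable to \<open>t\<close>, take a nonnegative
  polynomial \<open>f \<in> \<Pi>\<^sub>t\<close> that has a peak at \<open>x\<close>: it is of size at least \<open>(N/2)\<^sup>2\<^sup>d\<close> on the ball of radius
  \<open>1/N\<close> about \<open>x\<close>, and its mean over the sphere is only \<open>O(N\<^sup>d)\<close>. On the one hand the integral of \<open>f\<close>
  along the curve is \<open>\<ell>(\<gamma>)\<close> times this mean. On the other hand the curve starts at the centre
  of the ball and has to leave it, so it spends a length of at least \<open>1/N\<close> inside, where \<open>f\<close> is large.
  Together, \<open>(N/2)\<^sup>2\<^sup>d \<cdot> 1/N \<le> \<ell>(\<gamma>) \<cdot> O(N\<^sup>d)\<close>, which is \<open>\<ell>(\<gamma>) \<ge> c N\<^sup>d\<^sup>-\<^sup>1\<close>.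

  The curve leaves the ball because otherwise the linear polynomial \<open>y \<mapsto> x \<bullet> y\<close>, whose mean over the
  sphere is zero, would be positive on all of \<open>\<gamma>\<close> (\<open>design_curve_leaves_unit_ball\<close>). The lower
  bound for the integral along the curve is \<open>curve_integral_ge_peak\<close>.

  The peak polynomial is \<open>f(y) = W\<^sub>N(x \<bullet> y)\<^sup>2\<^sup>d\<close>, where \<open>W\<^sub>N(cos \<theta>) = sin(N\<theta>) / sin \<theta>\<close> is the
  Chebyshev polynomial of the second kind of degree \<open>N - 1\<close>. The bounds \<open>\<bar>W\<^sub>N(u)\<bar> \<le> N\<close> and
  \<open>W\<^sub>N(u)\<^sup>2 \<le> 1/(1 - u\<^sup>2)\<close> on \<open>[-1,1]\<close> show that \<open>f\<close> decays away from \<open>\<plusminus>x\<close> on the scale \<open>1/N\<close>. A dyadic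
  decomposition into double caps \<open>{1 - (x \<bullet> y)\<^sup>2 \<le> r\<^sup>2}\<close>, each of measure \<open>O(r\<^sup>d)\<close>, turns this decay into
  the bound for the mean (\<open>integral_sphere_chebyshev_W_power_le\<close>). The power \<open>2d\<close> makes the
  dyadic series converge geometrically.
\<close>

section \<open>Polynomials of bounded total degree\<close>

lemma monomial_mem_poly_space:
  fixes \<alpha> :: "'n::finite \<Rightarrow> nat"
  assumes "(\<Sum>i\<in>UNIV. \<alpha> i) \<le> t"
  shows "(\<lambda>x. a * (\<Prod>i\<in>UNIV. (x $ i) ^ \<alpha> i)) \<in> poly_space t"
proof -
  have "(\<Sum>\<beta> | (\<Sum>i\<in>UNIV. \<beta> i) \<le> t. (if \<beta> = \<alpha> then a else 0) * (\<Prod>i\<in>UNIV. (x $ i) ^ \<beta> i))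
      = a * (\<Prod>i\<in>UNIV. (x $ i) ^ \<alpha> i)" for x :: "real ^ 'n"
    using assms by (simp add: if_distrib[of "\<lambda>c. c * _"] finite_multi_indices cong: if_cong)
  then show ?thesis
    unfolding poly_space_def
    by (intro CollectI exI[of _ "\<lambda>\<beta>. if \<beta> = \<alpha> then a else 0"]) simp
qed

lemma poly_space_add:
  assumes "f \<in> poly_space t" "g \<in> poly_space t"
  shows "(\<lambda>x. f x + g x) \<in> poly_space t"
proof -
  obtain c where c: "f = (\<lambda>x. \<Sum>\<alpha> | (\<Sum>i\<in>UNIV. \<alpha> i) \<le> t. c \<alpha> * (\<Prod>i\<in>UNIV. (x $ i) ^ \<alpha> i))"
    using assms(1) unfolding poly_space_def by blast
  obtain d where d: "g = (\<lambda>x. \<Sum>\<alpha> | (\<Sum>i\<in>UNIV. \<alpha> i) \<le> t. d \<alpha> * (\<Prod>i\<in>UNIV. (x $ i) ^ \<alpha> i))"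
    using assms(2) unfolding poly_space_def by blast
  have "(\<lambda>x. f x + g x) =
      (\<lambda>x. \<Sum>\<alpha> | (\<Sum>i\<in>UNIV. \<alpha> i) \<le> t. (c \<alpha> + d \<alpha>) * (\<Prod>i\<in>UNIV. (x $ i) ^ \<alpha> i))"
    unfolding c d by (simp add: distrib_right sum.distrib)
  then show ?thesis unfolding poly_space_def by (intro CollectI exI[of _ "\<lambda>\<alpha>. c \<alpha> + d \<alpha>"]) simp
qed

lemma poly_space_const: "(\<lambda>x :: real ^ 'n. a) \<in> poly_space t"
  using monomial_mem_poly_space[of "\<lambda>_. 0" t a] by simp

lemma poly_space_sum:
  assumes "\<And>i. i \<in> I \<Longrightarrow> f i \<in> poly_space t"
  shows "(\<lambda>x. \<Sum>i\<in>I. f i x) \<in> poly_space t"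
  using assms
  by (induction I rule: infinite_finite_induct) (auto simp: poly_space_const intro: poly_space_add)

lemma poly_space_mult:
  assumes "f \<in> poly_space s" "g \<in> poly_space t"
  shows "(\<lambda>x. f x * g x) \<in> poly_space (s + t)"
proof -
  obtain c where c: "f = (\<lambda>x. \<Sum>\<alpha> | (\<Sum>i\<in>UNIV. \<alpha> i) \<le> s. c \<alpha> * (\<Prod>i\<in>UNIV. (x $ i) ^ \<alpha> i))"
    using assms(1) unfolding poly_space_def by blast
  obtain d where d: "g = (\<lambda>x. \<Sum>\<alpha> | (\<Sum>i\<in>UNIV. \<alpha> i) \<le> t. d \<alpha> * (\<Prod>i\<in>UNIV. (x $ i) ^ \<alpha> i))"
    using assms(2) unfolding poly_space_def by blast
  have "(\<lambda>x. f x * g x) =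
      (\<lambda>x. \<Sum>\<alpha> | (\<Sum>i\<in>UNIV. \<alpha> i) \<le> s. \<Sum>\<beta> | (\<Sum>i\<in>UNIV. \<beta> i) \<le> t.
        c \<alpha> * d \<beta> * (\<Prod>i\<in>UNIV. (x $ i) ^ (\<alpha> i + \<beta> i)))"
    unfolding c d by (simp add: sum_product power_add prod.distrib ac_simps)
  also have "\<dots> \<in> poly_space (s + t)"
    by (intro poly_space_sum monomial_mem_poly_space) (auto simp: sum.distrib)
  finally show ?thesis .
qed

lemma poly_space_mono:
  assumes "f \<in> poly_space s" "s \<le> t"
  shows "f \<in> poly_space t"
  using poly_space_mult[OF assms(1) poly_space_const[of 1 "t - s"]] assms(2) by simp

lemma poly_space_diff:
  assumes "f \<in> poly_space t" "g \<in> poly_space t"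
  shows "(\<lambda>x. f x - g x) \<in> poly_space t"
  using poly_space_add[OF assms(1) poly_space_mult[OF poly_space_const[of "-1" 0] assms(2), simplified]]
  by simp

lemma poly_space_power:
  assumes "f \<in> poly_space t"
  shows "(\<lambda>x. f x ^ k) \<in> poly_space (k * t)"
  by (induction k) (auto simp: poly_space_const intro: poly_space_mult[OF assms])

lemma poly_space_inner: "(\<lambda>y. x \<bullet> y) \<in> poly_space 1"
proof -
  have "(\<lambda>y. x $ i * y $ i) \<in> poly_space 1" for i
  proof -
    have "(\<Prod>j\<in>UNIV. (y $ j) ^ (if j = i then 1 else 0)) = y $ i" for y :: "real ^ 'a"
      by (simp add: if_distrib[of "power _"] cong: if_cong)
    then show ?thesis
      using monomial_mem_poly_space[of "\<lambda>j. if j = i then 1 else 0" 1 "x $ i"] by simp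
  qed
  then show ?thesis
    unfolding inner_vec_def by (simp add: poly_space_sum)
qed

lemma poly_space_imp_continuous:
  assumes "f \<in> poly_space t"
  shows "continuous_on A f"
  using assms unfolding poly_space_def by (auto intro!: continuous_intros)

section \<open>Chebyshev polynomials\<close>

text \<open>
  \<open>chebyshev_W n (cos \<theta>) = sin (n * \<theta>) / sin \<theta>\<close>, so the index of \<open>chebyshev_W\<close> is one more than its
  degree. The recursion is the pair of addition formulas for \<open>cos ((n + 1) * \<theta>)\<close> and
  \<open>sin ((n + 1) * \<theta>)\<close>. With both families at hand, the estimates below are inductions on \<open>n\<close> in the
  variable \<open>u = cos \<theta>\<close>, and no angle has to be introduced.
\<close>
fun chebyshev_T :: "nat \<Rightarrow> real \<Rightarrow> real" and chebyshev_W :: "nat \<Rightarrow> real \<Rightarrow> real" where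
  "chebyshev_T 0 u = 1"
| "chebyshev_T (Suc n) u = u * chebyshev_T n u - (1 - u\<^sup>2) * chebyshev_W n u"
| "chebyshev_W 0 u = 0"
| "chebyshev_W (Suc n) u = u * chebyshev_W n u + chebyshev_T n u"

text \<open>
  This is \<open>cos\<^sup>2 + sin\<^sup>2 = 1\<close> for the angle \<open>n * \<theta>\<close>. It yields both the bound on \<open>chebyshev_T\<close> and the decay
  of \<open>chebyshev_W\<close> away from \<open>u = \<plusminus>1\<close>.
\<close>
lemma chebyshev_pell: "(chebyshev_T n u)\<^sup>2 + (1 - u\<^sup>2) * (chebyshev_W n u)\<^sup>2 = 1"
proof (induction n)
  case (Suc n)
  have "(u * T - (1 - u\<^sup>2) * W)\<^sup>2 + (1 - u\<^sup>2) * (u * W + T)\<^sup>2 = T\<^sup>2 + (1 - u\<^sup>2) * W\<^sup>2" for T W :: real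
    by algebra
  with Suc show ?case by simp
qed simp

lemma chebyshev_T_abs_le:
  assumes "\<bar>u\<bar> \<le> 1"
  shows "\<bar>chebyshev_T n u\<bar> \<le> 1"
proof -
  have "0 \<le> (1 - u\<^sup>2) * (chebyshev_W n u)\<^sup>2"
    using assms by (intro mult_nonneg_nonneg) (auto simp: abs_square_le_1)
  then have "(chebyshev_T n u)\<^sup>2 \<le> 1" using chebyshev_pell[of n u] by linarith
  then show ?thesis by (simp add: abs_square_le_1)
qed

lemma chebyshev_W_abs_le:
  assumes "\<bar>u\<bar> \<le> 1"
  shows "\<bar>chebyshev_W n u\<bar> \<le> n"
proof (induction n)
  case (Suc n)
  have "\<bar>u * chebyshev_W n u\<bar> \<le> 1 * \<bar>chebyshev_W n u\<bar>"
    unfolding abs_mult by (intro mult_right_mono assms) auto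
  with Suc chebyshev_T_abs_le[OF assms, of n] show ?case by simp
qed simp

lemma chebyshev_W_square_le: "(1 - u\<^sup>2) * (chebyshev_W n u)\<^sup>2 \<le> 1"
  using chebyshev_pell[of n u] zero_le_power2[of "chebyshev_T n u"] by linarith

text \<open>
  One step of the recursion lowers \<open>chebyshev_T\<close> by at most \<open>(1 - u) + 2 * (1 - u) * n\<close>, and the odd
  numbers add up to a square.
\<close>
lemma chebyshev_T_ge:
  assumes "\<bar>u\<bar> \<le> 1"
  shows "1 - (1 - u) * (real n)\<^sup>2 \<le> chebyshev_T n u"
proof (induction n)
  case (Suc n)
  have "(1 - u) * chebyshev_T n u \<le> (1 - u) * 1"
    using chebyshev_T_abs_le[OF assms, of n] assms by (intro mult_left_mono) auto
  moreover have "(1 - u\<^sup>2) * chebyshev_W n u \<le> (2 * (1 - u)) * n"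
  proof -
    have "(1 - u\<^sup>2) * chebyshev_W n u \<le> (1 - u\<^sup>2) * n"
      using chebyshev_W_abs_le[OF assms, of n] assms
      by (intro mult_left_mono) (auto simp: abs_square_le_1)
    also have "1 - u\<^sup>2 \<le> 2 * (1 - u)" using zero_le_power2[of "1 - u"] by (simp add: power2_eq_square algebra_simps)
    finally show ?thesis by (simp add: mult_right_mono)
  qed
  ultimately show ?case using Suc by (simp add: power2_eq_square algebra_simps)
qed simp

text \<open>
  On the scale \<open>1 - u \<le> 1 / (2 * n\<^sup>2)\<close>, that is \<open>\<theta>\<close> up to about \<open>1/n\<close>, each of the first \<open>n\<close> steps adds
  at least \<open>1/2\<close> to \<open>chebyshev_W\<close>, so this polynomial keeps half of \<open>n\<close>,
  its value at \<open>u = 1\<close> and its maximum on \<open>[-1,1]\<close>.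
\<close>
lemma chebyshev_W_ge:
  assumes u: "\<bar>u\<bar> \<le> 1" and near: "(1 - u) * (real n)\<^sup>2 \<le> 1 / 2"
  shows "real n / 2 \<le> chebyshev_W n u"
proof -
  have "real j / 2 \<le> chebyshev_W j u" if "j \<le> n" for j
    using that
  proof (induction j)
    case (Suc j)
    have "(1 - u) * chebyshev_W j u \<le> (1 - u) * j"
      using chebyshev_W_abs_le[OF u, of j] u by (intro mult_left_mono) auto
    moreover have "(1 - u) * ((real j)\<^sup>2 + j) \<le> (1 - u) * (real n)\<^sup>2"
    proof -
      have "(real j)\<^sup>2 + j \<le> (real (Suc j))\<^sup>2" by (simp add: power2_eq_square algebra_simps)
      also have "\<dots> \<le> (real n)\<^sup>2" using Suc.prems by (intro power_mono) auto
      finally show ?thesis using u by (intro mult_left_mono) auto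
    qed
    ultimately have "(1 - u) * chebyshev_W j u + (1 - u) * (real j)\<^sup>2 \<le> 1 / 2"
      using near by (simp add: algebra_simps)
    with chebyshev_T_ge[OF u, of j] Suc show ?case by (simp add: algebra_simps)
  qed simp
  then show ?thesis by simp
qed

text \<open>
  In the defining recursion the term \<open>(1 - u\<^sup>2) W\<^sub>n\<close> has the right degree \<open>n + 1\<close> only because \<open>W\<^sub>n\<close>
  has degree \<open>n - 1\<close>, which is awkward at \<open>n = 0\<close>. The relation \<open>T\<^sub>n\<^sub>+\<^sub>1 = u W\<^sub>n\<^sub>+\<^sub>1 - W\<^sub>n\<close> avoids
  the quadratic factor.
\<close>
lemma chebyshev_W_inner_mem_poly_space: "(\<lambda>y. chebyshev_W (Suc n) (x \<bullet> y)) \<in> poly_space n"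
proof -
  have three: "chebyshev_T (Suc n) u = u * chebyshev_W (Suc n) u - chebyshev_W n u" for n u
    by (simp add: algebra_simps power2_eq_square)
  have inner: "(\<lambda>y. x \<bullet> y * f y) \<in> poly_space (Suc n)" if "f \<in> poly_space n" for f n
    using poly_space_mult[OF poly_space_inner[of x] that] by simp
  have "(\<lambda>y. chebyshev_T n (x \<bullet> y)) \<in> poly_space n \<and> (\<lambda>y. chebyshev_W (Suc n) (x \<bullet> y)) \<in> poly_space n
      \<and> (\<lambda>y. chebyshev_W n (x \<bullet> y)) \<in> poly_space n"
  proof (induction n)
    case (Suc n)
    then have W: "(\<lambda>y. chebyshev_W (Suc n) (x \<bullet> y)) \<in> poly_space n"
      and W': "(\<lambda>y. chebyshev_W n (x \<bullet> y)) \<in> poly_space (Suc n)"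
      by (auto intro: poly_space_mono)
    have T: "(\<lambda>y. chebyshev_T (Suc n) (x \<bullet> y)) \<in> poly_space (Suc n)"
      unfolding three by (intro poly_space_diff inner W W')
    have "(\<lambda>y. chebyshev_W (Suc (Suc n)) (x \<bullet> y)) \<in> poly_space (Suc n)"
      unfolding chebyshev_W.simps(2)[of "Suc n"] by (intro poly_space_add inner W T)
    with T W show ?case by (auto intro: poly_space_mono)
  qed (simp add: poly_space_const)
  then show ?thesis by blast
qed

lemma continuous_on_chebyshev: "continuous_on A (chebyshev_T n) \<and> continuous_on A (chebyshev_W n)"
proof (induction n)
  case (Suc n)
  then show ?case by (auto simp: chebyshev_T.simps(2)[abs_def] chebyshev_W.simps(2)[abs_def] intro!: continuous_intros)
qed (auto simp: chebyshev_T.simps(1)[abs_def] chebyshev_W.simps(1)[abs_def])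

section \<open>Integrals over the sphere\<close>

lemma integral_sphere_measure_inner_eq_0:
  "(\<integral>y. x \<bullet> y \<partial>sphere_measure) = (0::real)" for x :: "'a::euclidean_space"
proof -
  have "(\<integral>y. x \<bullet> y \<partial>sphere_measure) = (\<integral>y. x \<bullet> y \<partial>distr sphere_measure borel (uminus :: 'a \<Rightarrow> 'a))"
    by (subst distr_sphere_measure_orthogonal_transformation)
      (auto simp: orthogonal_transformation_def linear_iff)
  also have "\<dots> = - (\<integral>y. x \<bullet> y \<partial>sphere_measure)"
    by (subst integral_distr) (auto cong: measurable_cong_sets)
  finally show ?thesis by simp
qed

lemma integral_sphere_measure_zonal:
  fixes x e :: "real ^ 'n::finite" and h :: "real \<Rightarrow> real"
  assumes "norm x = norm e" and h [measurable]: "h \<in> borel_measurable borel"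
  shows "(\<integral>y. h (x \<bullet> y) \<partial>sphere_measure) = (\<integral>y. h (e \<bullet> y) \<partial>sphere_measure)"
proof -
  obtain A where A: "orthogonal_transformation A" "A e = x"
    using orthogonal_transformation_exists[of e x] assms(1) by metis
  have [measurable]: "A \<in> borel_measurable sphere_measure"
    using measurable_orthogonal_transformation[OF A(1)] by (simp cong: measurable_cong_sets)
  have "(\<integral>y. h (x \<bullet> y) \<partial>sphere_measure) = (\<integral>y. h (x \<bullet> y) \<partial>distr sphere_measure borel A)"
    by (simp add: distr_sphere_measure_orthogonal_transformation A(1))
  also have "\<dots> = (\<integral>y. h (x \<bullet> A y) \<partial>sphere_measure)"
    by (subst integral_distr) auto
  also have "\<dots> = (\<integral>y. h (e \<bullet> y) \<partial>sphere_measure)"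
    using A by (metis (no_types) orthogonal_transformation_def)
  finally show ?thesis .
qed

text \<open>
  The sphere measure of a set is the relative volume of its cone in the unit ball. The cone over the
  double cap lies in a box: along the axis \<open>k\<close> it has length at most \<open>2\<close>, and in every other
  direction \<open>i\<close> a point \<open>z\<close> of it satisfies \<open>z\<^sub>i\<^sup>2 \<le> \<parallel>z\<parallel>\<^sup>2 - z\<^sub>k\<^sup>2 \<le> r\<^sup>2 \<parallel>z\<parallel>\<^sup>2 \<le> r\<^sup>2\<close>.
\<close>
lemma measure_sphere_double_cap_le:
  fixes k :: "'n::finite"
  assumes r: "0 \<le> r"
  shows "measure sphere_measure {y :: real ^ 'n. 1 - (y $ k)\<^sup>2 \<le> r\<^sup>2}
    \<le> 2 * (2 * r) ^ (CARD('n) - 1) / measure lborel (ball (0 :: real ^ 'n) 1)"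
proof -
  let ?C = "{y :: real ^ 'n. 1 - (y $ k)\<^sup>2 \<le> r\<^sup>2}"
  let ?\<rho> = "\<lambda>x :: real ^ 'n. x /\<^sub>R norm x"
  let ?B = "ball (0 :: real ^ 'n) 1"
  let ?b = "(\<chi> i. if i = k then 1 else r) :: real ^ 'n"
  have C [measurable]: "?C \<in> sets borel"
    by (intro borel_closed closed_Collect_le continuous_intros)
  have pre: "?\<rho> -` ?C \<in> sets borel"
    using measurable_sets_borel[OF measurable_radial C] by simp
  have sub: "?B \<inter> ?\<rho> -` ?C \<subseteq> cbox (- ?b) ?b"
  proof
    fix z assume z: "z \<in> ?B \<inter> ?\<rho> -` ?C"
    show "z \<in> cbox (- ?b) ?b"
    proof (cases "z = 0")
      case True
      then show ?thesis using r by (auto simp: mem_box_cart)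
    next
      case False
      have nz: "0 < norm z" "norm z \<le> 1" using False z by auto
      have "\<bar>z $ i\<bar> \<le> ?b $ i" for i
      proof (cases "i = k")
        case True
        then show ?thesis using component_le_norm_cart[of z k] nz by simp
      next
        case i: False
        have "(z $ i)\<^sup>2 + (z $ k)\<^sup>2 = (\<Sum>j\<in>{i, k}. (z $ j)\<^sup>2)" using i by simp
        also have "\<dots> \<le> (\<Sum>j\<in>UNIV. (z $ j)\<^sup>2)" by (intro sum_mono2) auto
        also have "\<dots> = (norm z)\<^sup>2"
          by (simp add: norm_vec_def L2_set_def sum_nonneg)
        finally have 1: "(z $ i)\<^sup>2 + (z $ k)\<^sup>2 \<le> (norm z)\<^sup>2" .
        have "1 - (z $ k / norm z)\<^sup>2 \<le> r\<^sup>2" using z by (simp add: divide_inverse mult.commute)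
        then have "(norm z)\<^sup>2 - (z $ k)\<^sup>2 \<le> r\<^sup>2 * (norm z)\<^sup>2"
          using nz by (simp add: field_simps)
        also have "\<dots> \<le> r\<^sup>2 * 1" using nz by (intro mult_left_mono) (auto simp: power_le_one)
        finally have "(z $ i)\<^sup>2 \<le> r\<^sup>2" using 1 by simp
        then show ?thesis using i r by (simp add: abs_le_square_iff[symmetric])
      qed
      then show ?thesis by (auto simp: mem_box_cart abs_le_iff minus_le_iff)
    qed
  qed
  have "measure sphere_measure ?C = measure (uniform_measure lborel ?B) (?\<rho> -` ?C)"
    unfolding sphere_measure_def by (subst measure_distr) auto
  also have "\<dots> = measure lborel (?B \<inter> ?\<rho> -` ?C) / measure lborel ?B"
    using pre by (subst measure_uniform_measure) (use emeasure_lborel_unit_ball[where 'a = "real ^ 'n"] in auto)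
  also have "\<dots> \<le> measure lborel (cbox (- ?b) ?b) / measure lborel ?B"
  proof (intro divide_right_mono)
    show "measure lborel (?B \<inter> ?\<rho> -` ?C) \<le> measure lborel (cbox (- ?b) ?b)"
      using sub pre emeasure_lborel_cbox_finite[of "- ?b" ?b]
      by (intro measure_mono_fmeasurable) (auto simp: fmeasurable_def)
  qed simp
  also have "measure lborel (cbox (- ?b) ?b) = (\<Prod>i\<in>UNIV. 2 * (?b $ i))"
  proof -
    have "cbox (- ?b) ?b \<noteq> {}" using r by (auto simp: interval_ne_empty_cart)
    then show ?thesis by (simp add: content_cbox_cart[simplified])
  qed
  also have "\<dots> = 2 * (2 * r) ^ (CARD('n) - 1)"
  proof -
    have "(\<Prod>i\<in>UNIV - {k}. 2 * (?b $ i)) = (\<Prod>i\<in>UNIV - {k}. 2 * r)" by (intro prod.cong) auto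
    then show ?thesis by (subst prod.remove[of _ k]) (auto simp: card_Diff_singleton)
  qed
  finally show ?thesis .
qed


text \<open>
  If \<open>j\<close> is the least index with \<open>1 - u\<^sup>2 \<le> (2\<^sup>j / N)\<^sup>2\<close>, the decay of \<open>chebyshev_W\<close> gives a bound of
  order \<open>N\<^sup>2 / 4\<^sup>j\<close> for its square. Summing over all scales instead of selecting this one makes the
  bound a combination of indicators of double caps. The scales up to \<open>N\<close> suffice because \<open>N < 2\<^sup>N\<close>.
\<close>
lemma chebyshev_W_power_le_dyadic:
  assumes u: "\<bar>u\<bar> \<le> 1" and N: "N \<ge> 1"
  shows "chebyshev_W N u ^ (2 * d) \<le>
    (\<Sum>j\<le>N. (4 * (real N)\<^sup>2 / 4 ^ j) ^ d * indicator {u. 1 - u\<^sup>2 \<le> (2 ^ j / real N)\<^sup>2} u)"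
proof -
  let ?P = "\<lambda>j. 1 - u\<^sup>2 \<le> (2 ^ j / real N)\<^sup>2"
  define j where "j = (LEAST j. ?P j)"
  have "1 - u\<^sup>2 \<le> (1::real)\<^sup>2" by simp
  also have "\<dots> \<le> (2 ^ N / real N)\<^sup>2"
    using N of_nat_less_two_power[of N, where 'a = real] by (intro power_mono) (auto simp: field_simps)
  finally have PN: "?P N" .
  then have j: "?P j" "j \<le> N" unfolding j_def by (auto intro: LeastI Least_le)
  \<comment> \<open>For \<open>j = 0\<close> the uniform bound is used. For \<open>j = i + 1\<close> minimality gives \<open>1 - u\<^sup>2 > 4\<^sup>i / N\<^sup>2\<close>, and
    passing from \<open>i\<close> to \<open>j\<close> costs the factor 4.\<close>
  have W: "(chebyshev_W N u)\<^sup>2 \<le> 4 * (real N)\<^sup>2 / 4 ^ j"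
  proof (cases j)
    case 0
    have "(chebyshev_W N u)\<^sup>2 \<le> (real N)\<^sup>2"
      using chebyshev_W_abs_le[OF u, of N] by (simp add: abs_le_square_iff[symmetric])
    also have "\<dots> \<le> 4 * (real N)\<^sup>2" by simp
    finally show ?thesis using 0 by simp
  next
    case (Suc i)
    then have "\<not> ?P i" unfolding j_def by (metis lessI not_less_Least)
    then have "(2 ^ i / real N)\<^sup>2 * (chebyshev_W N u)\<^sup>2 \<le> (1 - u\<^sup>2) * (chebyshev_W N u)\<^sup>2"
      by (intro mult_right_mono) auto
    also have "\<dots> \<le> 1" by (rule chebyshev_W_square_le)
    finally show ?thesis
      using N Suc by (simp add: field_simps power2_eq_square flip: power_mult_distrib)
  qed
  have "chebyshev_W N u ^ (2 * d) \<le> (4 * (real N)\<^sup>2 / 4 ^ j) ^ d"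
    unfolding power_mult using W by (intro power_mono) auto
  also have "\<dots> = (4 * (real N)\<^sup>2 / 4 ^ j) ^ d * indicator {u. 1 - u\<^sup>2 \<le> (2 ^ j / real N)\<^sup>2} u"
    using j by simp
  also have "\<dots> \<le> (\<Sum>j\<le>N. (4 * (real N)\<^sup>2 / 4 ^ j) ^ d * indicator {u. 1 - u\<^sup>2 \<le> (2 ^ j / real N)\<^sup>2} u)"
    using j(2) by (intro member_le_sum) auto
  finally show ?thesis .
qed

text \<open>
  At scale \<open>j\<close> the integrand is of order \<open>(N\<^sup>2 / 4\<^sup>j)\<^sup>d\<close> and the double cap has measure of order
  \<open>(2\<^sup>j / N)\<^sup>d\<close>. The product is of order \<open>N\<^sup>d / 2\<^sup>j\<^sup>d\<close>, which is summable in \<open>j\<close>.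
\<close>
lemma integral_sphere_chebyshev_W_power_le:
  fixes x :: "real ^ 'n::finite"
  assumes x: "norm x = 1" and d: "d \<ge> 1" "CARD('n) = d + 1" and N: "N \<ge> 1"
  shows "(\<integral>y. chebyshev_W N (x \<bullet> y) ^ (2 * d) \<partial>sphere_measure)
    \<le> 4 * 8 ^ d / measure lborel (ball (0 :: real ^ 'n) 1) * real N ^ d"
proof -
  interpret prob_space "sphere_measure :: (real ^ 'n) measure" by (rule prob_space_sphere_measure)
  let ?V = "measure lborel (ball (0 :: real ^ 'n) 1)"
  \<comment> \<open>By rotation invariance the peak may be moved to a coordinate axis, and any axis will do.\<close>
  define k :: 'n where "k = undefined"
  define c where "c j = (4 * (real N)\<^sup>2 / 4 ^ j) ^ d" for j :: nat
  define A where "A j = {y :: real ^ 'n. 1 - (y $ k)\<^sup>2 \<le> (2 ^ j / real N)\<^sup>2}" for j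
  have [measurable]: "A j \<in> sets borel" for j
    unfolding A_def by (intro borel_closed closed_Collect_le continuous_intros)
  have [measurable]: "chebyshev_W N \<in> borel_measurable borel"
    using continuous_on_chebyshev by (intro borel_measurable_continuous_onI) auto
  have "(\<integral>y. chebyshev_W N (x \<bullet> y) ^ (2 * d) \<partial>sphere_measure)
      = (\<integral>y. chebyshev_W N (axis k (1 :: real) \<bullet> y) ^ (2 * d) \<partial>sphere_measure)"
  proof (rule integral_sphere_measure_zonal[where h = "\<lambda>u. chebyshev_W N u ^ (2 * d)"])
    show "norm x = norm (axis k (1 :: real) :: real ^ 'n)" using x by simp
  qed measurable
  also have "\<dots> \<le> (\<integral>y. (\<Sum>j\<le>N. c j * indicator (A j) y) \<partial>sphere_measure)"
  proof (rule integral_mono_AE')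
    show "integrable sphere_measure (\<lambda>y. \<Sum>j\<le>N. c j * indicator (A j) y)"
      by (intro Bochner_Integration.integrable_sum integrable_mult_right integrable_real_indicator)
         (auto simp: emeasure_eq_measure)
    show "AE y in sphere_measure. 0 \<le> (\<Sum>j\<le>N. c j * indicator (A j) y)"
      by (auto intro!: sum_nonneg simp: c_def)
    show "AE y in sphere_measure. chebyshev_W N (axis k (1 :: real) \<bullet> y) ^ (2 * d) \<le> (\<Sum>j\<le>N. c j * indicator (A j) y)"
      using AE_sphere_measure
    proof eventually_elim
      case (elim y)
      then have "\<bar>y $ k\<bar> \<le> 1" using component_le_norm_cart[of y k] by simp
      from chebyshev_W_power_le_dyadic[OF this N, of d] show ?case
        by (simp add: inner_axis' c_def A_def indicator_def)
    qed
  qed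
  also have "\<dots> = (\<Sum>j\<le>N. c j * prob (A j))"
    by (subst Bochner_Integration.integral_sum) (auto simp: emeasure_eq_measure)
  also have "\<dots> \<le> (\<Sum>j\<le>N. 2 * 8 ^ d / ?V * real N ^ d * (1 / 2) ^ j)"
  proof (rule sum_mono)
    fix j
    have "c j * prob (A j) \<le> c j * (2 * (2 * (2 ^ j / real N)) ^ d / ?V)"
      using measure_sphere_double_cap_le[of "2 ^ j / real N" k] d
      by (intro mult_left_mono) (auto simp: A_def c_def)
    also have "\<dots> = 2 / ?V * (4 * (real N)\<^sup>2 / 4 ^ j * (2 * (2 ^ j / real N))) ^ d"
      unfolding c_def power_mult_distrib[of "4 * (real N)\<^sup>2 / 4 ^ j"] by simp
    also have "4 * (real N)\<^sup>2 / 4 ^ j * (2 * (2 ^ j / real N)) = 8 * real N * (1 / 2) ^ j"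
    proof -
      have "(4 :: real) ^ j = 2 ^ j * 2 ^ j" by (simp flip: power_mult_distrib)
      then show ?thesis using N by (simp add: power2_eq_square power_divide)
    qed
    also have "2 / ?V * (8 * real N * (1 / 2) ^ j) ^ d = 2 * 8 ^ d / ?V * real N ^ d * ((1 / 2) ^ j) ^ d"
      by (simp add: power_mult_distrib)
    also have "\<dots> \<le> 2 * 8 ^ d / ?V * real N ^ d * ((1 / 2) ^ j) ^ 1"
      using d by (intro mult_left_mono power_decreasing) (auto simp: power_le_one)
    finally show "c j * prob (A j) \<le> 2 * 8 ^ d / ?V * real N ^ d * (1 / 2) ^ j" by simp
  qed
  also have "\<dots> = 2 * 8 ^ d / ?V * real N ^ d * (\<Sum>j\<le>N. (1 / 2) ^ j)"
    by (simp add: sum_distrib_left)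
  also have "\<dots> \<le> 2 * 8 ^ d / ?V * real N ^ d * 2"
  proof (intro mult_left_mono)
    show "(\<Sum>j\<le>N. (1 / 2 :: real) ^ j) \<le> 2"
      using sum_gp_basic[of "1 / 2 :: real" N] by simp
  qed auto
  finally show ?thesis by (simp add: mult_ac)
qed

section \<open>Curves on the sphere\<close>

text \<open>
  The speed may blow up at the exceptional parameters. It is integrable because the integral of a
  nonintegrable function has the value \<open>0\<close>, whereas the length of a \<open>sphere_curve\<close> is positive.
\<close>
lemma sphere_curve_speed_integrable:
  assumes "sphere_curve \<gamma>" "{a..b} \<subseteq> {0..1}"
  shows "(\<lambda>s. norm (vector_derivative \<gamma> (at s))) integrable_on {a..b}"
proof -
  have "(\<lambda>s. norm (vector_derivative \<gamma> (at s))) integrable_on {0..1}"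
    using assms(1) not_integrable_integral unfolding sphere_curve_def curve_length_def by fastforce
  then show ?thesis using assms(2) by (rule integrable_on_subinterval)
qed

lemma sphere_curve_continuous:
  assumes "sphere_curve \<gamma>"
  shows "continuous_on {0..1} \<gamma>"
  using assms unfolding sphere_curve_def valid_path_def piecewise_C1_differentiable_on_def by blast

lemma sphere_curve_norm:
  assumes "sphere_curve \<gamma>" "s \<in> {0..1}"
  shows "norm (\<gamma> s) = 1"
  using assms unfolding sphere_curve_def path_image_def by (auto simp: image_subset_iff)

lemma curve_integrand_integrable:
  fixes \<gamma> :: "real \<Rightarrow> 'a::euclidean_space"
  assumes "sphere_curve \<gamma>" "continuous_on (sphere 0 1) f" "{a..b} \<subseteq> {0..1}"
  shows "(\<lambda>s. f (\<gamma> s) * norm (vector_derivative \<gamma> (at s))) integrable_on {a..b}"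
proof -
  have "continuous_on {0..1} (\<lambda>s. f (\<gamma> s))"
    by (rule continuous_on_compose2[OF assms(2) sphere_curve_continuous[OF assms(1)]])
      (auto simp: sphere_curve_norm[OF assms(1)])
  then have cont: "continuous_on {a..b} (\<lambda>s. f (\<gamma> s))"
    using assms(3) by (rule continuous_on_subset)
  have "(\<lambda>s. f (\<gamma> s) * norm (vector_derivative \<gamma> (at s))) absolutely_integrable_on {a..b}"
  proof (rule absolutely_integrable_bounded_measurable_product_real)
    show "(\<lambda>s. f (\<gamma> s)) \<in> borel_measurable (lebesgue_on {a..b})"
      using cont by (intro continuous_imp_measurable_on_sets_lebesgue) auto
    show "bounded ((\<lambda>s. f (\<gamma> s)) ` {a..b})"
      using cont by (intro compact_imp_bounded compact_continuous_image) auto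
    show "(\<lambda>s. norm (vector_derivative \<gamma> (at s))) absolutely_integrable_on {a..b}"
      using sphere_curve_speed_integrable[OF assms(1,3)] by (intro nonnegative_absolutely_integrable_1) auto
  qed simp
  then show ?thesis by (rule set_lebesgue_integral_eq_integral(1))
qed

lemma chord_le_arc_length:
  fixes \<gamma> :: "real \<Rightarrow> 'a::euclidean_space"
  assumes \<gamma>: "sphere_curve \<gamma>" and ab: "0 \<le> a" "a \<le> b" "b \<le> 1"
  shows "norm (\<gamma> b - \<gamma> a) \<le> integral {a..b} (\<lambda>s. norm (vector_derivative \<gamma> (at s)))"
proof -
  obtain S where S: "finite S" "\<gamma> C1_differentiable_on ({0..1} - S)"
    using \<gamma> unfolding sphere_curve_def valid_path_def piecewise_C1_differentiable_on_def by blast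
  have "((\<lambda>s. vector_derivative \<gamma> (at s)) has_integral (\<gamma> b - \<gamma> a)) {a..b}"
  proof (rule fundamental_theorem_of_calculus_interior_strong[OF S(1) ab(2)])
    fix s assume "s \<in> {a<..<b} - S"
    then have "s \<in> {0..1} - S" using ab by auto
    then show "(\<gamma> has_vector_derivative vector_derivative \<gamma> (at s)) (at s)"
      using S(2) by (auto simp: C1_differentiable_on_eq vector_derivative_works)
  next
    show "continuous_on {a..b} \<gamma>"
      using sphere_curve_continuous[OF \<gamma>] ab by (auto intro: continuous_on_subset)
  qed
  then have "(\<lambda>s. vector_derivative \<gamma> (at s)) integrable_on {a..b}"
    and eq: "integral {a..b} (\<lambda>s. vector_derivative \<gamma> (at s)) = \<gamma> b - \<gamma> a"
    by (auto simp: has_integral_integrable integral_unique)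
  then show ?thesis
    using sphere_curve_speed_integrable[OF \<gamma>, of a b] ab
    by (subst eq[symmetric], intro integral_norm_bound_integral) auto
qed

text \<open>
  The set of parameters at distance exactly \<open>r\<close> is compact, and its least element is the wanted one: a
  point further away at an earlier time would, by the intermediate value theorem, be preceded
  by another point at distance \<open>r\<close>.
\<close>
lemma first_exit_time:
  fixes \<gamma> :: "real \<Rightarrow> 'a::metric_space"
  assumes cont: "continuous_on {0..1} \<gamma>" and r: "0 \<le> r"
    and exit: "s1 \<in> {0..1}" "r \<le> dist (\<gamma> 0) (\<gamma> s1)"
  obtains b where "b \<in> {0..1}" "dist (\<gamma> 0) (\<gamma> b) = r" "\<And>s. s \<in> {0..b} \<Longrightarrow> dist (\<gamma> 0) (\<gamma> s) \<le> r"
proof -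
  let ?g = "\<lambda>s. dist (\<gamma> 0) (\<gamma> s)"
  have g: "continuous_on {0..1} ?g" using cont by (intro continuous_intros)
  let ?E = "{s \<in> {0..1}. ?g s = r}"
  have hit: "\<exists>s. 0 \<le> s \<and> s \<le> t \<and> ?g s = r" if "t \<in> {0..1}" "r \<le> ?g t" for t
    using that r by (intro IVT') (auto intro: continuous_on_subset[OF g])
  have "compact ?E"
  proof -
    have "closed ?E"
      using continuous_closed_preimage[OF g, of "{r}"] by (simp add: vimage_def Int_def)
    then have "compact ({0..1} \<inter> ?E)" by (intro compact_Int_closed) auto
    moreover have "{0..1} \<inter> ?E = ?E" by blast
    ultimately show ?thesis by metis
  qed
  moreover have "?E \<noteq> {}" using hit[OF exit] exit(1) by fastforce
  ultimately obtain b where b: "b \<in> ?E" "\<And>s. s \<in> ?E \<Longrightarrow> b \<le> s"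
    using compact_attains_inf[of ?E] by blast
  have "?g s \<le> r" if s: "s \<in> {0..b}" for s
  proof (rule ccontr)
    assume "\<not> ?g s \<le> r"
    moreover from this obtain q where "0 \<le> q" "q \<le> s" "?g q = r"
      using hit[of s] s b(1) by auto
    moreover from this have "b \<le> q" using b s by auto
    ultimately show False using s by (metis atLeastAtMost_iff order.antisym order.refl order.trans)
  qed
  with b(1) that show ?thesis by blast
qed

text \<open>
  Up to the first exit from the ball, the arc joins its centre to its boundary and so has length at
  least \<open>r\<close>, while \<open>f\<close> is at least \<open>M\<close> on it. As \<open>f\<close> is nonnegative, the rest of the curve can only
  increase the integral.
\<close>
lemma curve_integral_ge_peak:
  fixes \<gamma> :: "real \<Rightarrow> 'a::euclidean_space"
  assumes \<gamma>: "sphere_curve \<gamma>" and f: "continuous_on (sphere 0 1) f" "\<And>y. 0 \<le> f y"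
    and r: "0 \<le> r" and exit: "s1 \<in> {0..1}" "r \<le> dist (\<gamma> 0) (\<gamma> s1)"
    and M: "0 \<le> M" "\<And>y. norm y = 1 \<Longrightarrow> dist (\<gamma> 0) y \<le> r \<Longrightarrow> M \<le> f y"
  shows "M * r \<le> curve_integral \<gamma> f"
proof -
  let ?v = "\<lambda>s. norm (vector_derivative \<gamma> (at s))"
  obtain b where b: "b \<in> {0..1}" "dist (\<gamma> 0) (\<gamma> b) = r"
    and near: "\<And>s. s \<in> {0..b} \<Longrightarrow> dist (\<gamma> 0) (\<gamma> s) \<le> r"
    using first_exit_time[OF sphere_curve_continuous[OF \<gamma>] r exit] by metis
  have "M * r \<le> M * integral {0..b} ?v"
    using chord_le_arc_length[OF \<gamma>, of 0 b] b M(1)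
    by (intro mult_left_mono) (auto simp: dist_norm norm_minus_commute)
  also have "\<dots> = integral {0..b} (\<lambda>s. M * ?v s)" by simp
  also have "\<dots> \<le> integral {0..b} (\<lambda>s. f (\<gamma> s) * ?v s)"
    using b(1) near M(2) sphere_curve_norm[OF \<gamma>]
    by (intro integral_le integrable_on_mult_right sphere_curve_speed_integrable[OF \<gamma>]
        curve_integrand_integrable[OF \<gamma> f(1)] mult_right_mono) auto
  also have "\<dots> \<le> integral {0..1} (\<lambda>s. f (\<gamma> s) * ?v s)"
    using b(1) f(2)
    by (intro integral_subset_le curve_integrand_integrable[OF \<gamma> f(1)]) auto
  finally show ?thesis by (simp add: curve_integral_def)
qed

text \<open>
  On the part of the sphere within distance \<open>1\<close> of \<open>\<gamma> 0\<close>, the function \<open>y \<mapsto> \<gamma> 0 \<bullet> y\<close> is at least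
  \<open>1/2\<close>, so it could not have mean zero along a curve that stays there.
\<close>
lemma design_curve_leaves_unit_ball:
  fixes \<gamma> :: "real \<Rightarrow> 'a::euclidean_space"
  assumes \<gamma>: "sphere_curve \<gamma>" and mean: "curve_integral \<gamma> (\<lambda>y. \<gamma> 0 \<bullet> y) = 0"
  shows "\<exists>s\<in>{0..1}. 1 \<le> dist (\<gamma> 0) (\<gamma> s)"
proof (rule ccontr)
  let ?v = "\<lambda>s. norm (vector_derivative \<gamma> (at s))"
  assume "\<not> ?thesis"
  then have near: "dist (\<gamma> 0) (\<gamma> s) < 1" if "s \<in> {0..1}" for s
    using that by (meson not_le)
  have "1 / 2 \<le> \<gamma> 0 \<bullet> \<gamma> s" if s: "s \<in> {0..1}" for s
  proof -
    have "(dist (\<gamma> 0) (\<gamma> s))\<^sup>2 = 2 - 2 * (\<gamma> 0 \<bullet> \<gamma> s)"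
      using sphere_curve_norm[OF \<gamma> s] sphere_curve_norm[OF \<gamma>, of 0]
      by (simp add: dist_norm dot_norm_neg field_simps)
    moreover have "(dist (\<gamma> 0) (\<gamma> s))\<^sup>2 \<le> 1" using near[OF s] by (simp add: power_le_one)
    ultimately show ?thesis by simp
  qed
  then have "integral {0..1} (\<lambda>s. 1 / 2 * ?v s) \<le> curve_integral \<gamma> (\<lambda>y. \<gamma> 0 \<bullet> y)"
    unfolding curve_integral_def
    by (intro integral_le integrable_on_mult_right sphere_curve_speed_integrable[OF \<gamma>]
        curve_integrand_integrable[OF \<gamma>] mult_right_mono continuous_intros) auto
  then show False
    using \<gamma> mean by (simp add: sphere_curve_def curve_length_def)
qed

section \<open>The lower bound for the length\<close>

theorem theorem1p1:
  fixes d :: nat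
  assumes "d \<ge> 1" and "CARD('n::finite) = d + 1"
  shows "\<exists>C::real. C > 0 \<and>
    (\<forall>t::nat. t \<ge> 1 \<longrightarrow>
      (\<forall>\<gamma> :: real \<Rightarrow> real ^ 'n.
        sphere_curve \<gamma> \<longrightarrow> closed_path \<gamma> \<longrightarrow>
        (\<forall>f \<in> poly_space t.
           (1 / curve_length \<gamma>) * curve_integral \<gamma> f = (\<integral>x. f x \<partial>sphere_measure)) \<longrightarrow>
        curve_length \<gamma> \<ge> C * real t ^ (d - 1)))"
proof -
  define K where "K = 4 * 8 ^ d / measure lborel (ball (0 :: real ^ 'n) 1)"
  have "0 < measure lborel (ball (0 :: real ^ 'n) 1)"
    using emeasure_lborel_unit_ball[where 'a = "real ^ 'n"]
    by (auto simp: measure_def zero_less_iff_neq_zero enn2real_eq_0_iff less_le)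
  then have K: "0 < K" by (simp add: K_def)
  define C where "C = 1 / (4 ^ d * K * (2 * real d) ^ (d - 1))"
  have C: "0 < C" using K assms(1) by (simp add: C_def)
  have "C * real t ^ (d - 1) \<le> curve_length \<gamma>"
    if t: "t \<ge> 1" and \<gamma>: "sphere_curve \<gamma>"
      and design: "\<forall>f \<in> poly_space t.
           (1 / curve_length \<gamma>) * curve_integral \<gamma> f = (\<integral>x. f x \<partial>sphere_measure)"
    for t :: nat and \<gamma> :: "real \<Rightarrow> real ^ 'n"
  proof -
    \<comment> \<open>\<open>n\<close> is the degree of \<open>chebyshev_W N\<close>. It is the largest one for which the power \<open>2 * d\<close> stays
      in \<open>poly_space t\<close>.\<close>
    define n where "n = t div (2 * d)"
    define N where "N = Suc n"
    let ?x = "\<gamma> 0" and ?l = "curve_length \<gamma>"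
    let ?f = "\<lambda>y. chebyshev_W N (?x \<bullet> y) ^ (2 * d)"
    have N0: "0 < real N" by (simp add: N_def)
    have l: "0 < ?l" using \<gamma> by (simp add: sphere_curve_def)
    have x: "norm ?x = 1" using sphere_curve_norm[OF \<gamma>, of 0] by simp
    have "2 * d * n \<le> t" by (simp add: n_def)
    then have f: "?f \<in> poly_space t"
      unfolding N_def by (rule poly_space_mono[OF poly_space_power[OF chebyshev_W_inner_mem_poly_space]])
    have "(\<lambda>y. ?x \<bullet> y) \<in> poly_space t"
      using t by (rule poly_space_mono[OF poly_space_inner])
    from bspec[OF design this] l have "curve_integral \<gamma> (\<lambda>y. ?x \<bullet> y) = 0"
      by (simp add: integral_sphere_measure_inner_eq_0)
    then obtain s1 where s1: "s1 \<in> {0..1}" "1 \<le> dist ?x (\<gamma> s1)"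
      using design_curve_leaves_unit_ball[OF \<gamma>] by blast
    \<comment> \<open>The ball of radius \<open>1 / N\<close> is where \<open>chebyshev_W N (?x \<bullet> y)\<close> keeps half of
      its value at \<open>y = ?x\<close>.\<close>
    have "(real N / 2) ^ (2 * d) * (1 / N) \<le> curve_integral \<gamma> ?f"
    proof (rule curve_integral_ge_peak[OF \<gamma> poly_space_imp_continuous[OF f] _ _ s1(1)])
      show "1 / real N \<le> dist ?x (\<gamma> s1)" 
        using s1(2) N0 by (intro order.trans[OF _ s1(2)]) (simp add: N_def)
      fix y :: "real ^ 'n" assume y: "norm y = 1" "dist ?x y \<le> 1 / real N"
      have chord: "1 - ?x \<bullet> y = (dist ?x y)\<^sup>2 / 2"
        using x y by (simp add: dist_norm dot_norm_neg field_simps)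
      have "(dist ?x y)\<^sup>2 \<le> (1 / real N)\<^sup>2" using y by (intro power_mono) auto
      then have "(1 - ?x \<bullet> y) * (real N)\<^sup>2 \<le> 1 / 2"
        unfolding chord using N0 by (simp add: power_divide pos_le_divide_eq)
      moreover have "\<bar>?x \<bullet> y\<bar> \<le> 1" using Cauchy_Schwarz_ineq2[of ?x y] x y by simp
      ultimately show "(real N / 2) ^ (2 * d) \<le> ?f y"
        by (intro power_mono chebyshev_W_ge) auto
    qed (auto simp: power_mult)
    also have "\<dots> = ?l * (\<integral>y. ?f y \<partial>sphere_measure)"
      using bspec[OF design f] l by (simp add: field_simps)
    also have "\<dots> \<le> ?l * (K * real N ^ d)"
      using integral_sphere_chebyshev_W_power_le[OF x assms, of N] l
      by (intro mult_left_mono) (auto simp: K_def N_def)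
    finally have main: "(real N / 2) ^ (2 * d) * (1 / N) \<le> ?l * (K * real N ^ d)" .
    have "(real N / 2) ^ (2 * d) * (1 / N) = real N ^ (d - 1) / 4 ^ d * real N ^ d"
    proof -
      obtain e where "d = Suc e" using assms(1) by (cases d) auto
      then show ?thesis using N0 by (simp add: power_mult power_divide power2_eq_square power_mult_distrib)
    qed
    with main have "real N ^ (d - 1) / 4 ^ d * real N ^ d \<le> ?l * K * real N ^ d"
      by (simp only: mult.assoc)
    then have "real N ^ (d - 1) / 4 ^ d \<le> ?l * K"
      by (rule mult_right_le_imp_le) (use N0 in simp)
    then have N: "real N ^ (d - 1) / (4 ^ d * K) \<le> ?l"
      using K by (simp add: field_simps)
    \<comment> \<open>It remains to replace \<open>N\<close> by \<open>t\<close>.\<close>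
    have "t \<le> 2 * d * N"
      using dividend_less_div_times[of "2 * d" t] assms(1) by (simp add: N_def n_def mult.commute)
    then have "real t ^ (d - 1) \<le> (2 * real d * real N) ^ (d - 1)"
      using of_nat_mono[of t "2 * d * N", where 'a = real] by (intro power_mono) auto
    then have "C * real t ^ (d - 1) \<le> C * (2 * real d * real N) ^ (d - 1)"
      using C by simp
    also have "\<dots> = real N ^ (d - 1) / (4 ^ d * K)"
      using assms(1) by (simp add: C_def power_mult_distrib)
    finally show ?thesis using N by simp
  qed
  with C show ?thesis by blast
qed

end
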